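(* Let $G$ be a simple 2-connected graph of order $n\ge 5$. If $G$ is $\{K_{1,3}, P_4\}$-free, then $G$ is chorded pancyclic.
   Context: $G$ is $\{H_1,\dots,H_r\}$-free if $G$ contains no induced subgraph isomorphic to any $H_i$. $K_{1,3}$ is the claw and $P_t$ denotes the path on $t$ vertices. A chorded cycle is a cycle $C$ such that $G$ has an edge joining two vertices nonconsecutive on $C$. A graph $G$ of order $n$ is chorded pancyclic if it contains a chorded cycle of every length $m$ with $4\le m\le n$. *)

theory Defs
  imports "Graph_Theory.Digraph_Isomorphism" "Graph_Theory.Kuratowski"
begin

text \<open>
  A finite simple graph is a symmetric loop-free digraph without parallel arcs; each undirected
  edge is represented by its two orientations.
\<close>

definition k_connected :: "nat \<Rightarrow> ('a, 'b) pre_digraph \<Rightarrow> bool" where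
  "k_connected k G \<longleftrightarrow> k < card (verts G) \<and>
     (\<forall>S \<subseteq> verts G. card S < k \<longrightarrow> connected (G \<restriction> (verts G - S)))"

definition free_of :: "('c, 'd) pre_digraph set \<Rightarrow> ('a, 'b) pre_digraph \<Rightarrow> bool" where
  "free_of \<H> G \<longleftrightarrow> (\<forall>H \<in> \<H>. \<not> (\<exists>F. induced_subgraph F G \<and> digraph_iso F H))"

definition complete_bipartite_graph :: "nat \<Rightarrow> nat \<Rightarrow> nat pair_pre_digraph" where
  "complete_bipartite_graph m n =
     \<lparr>pverts = {0..<m + n}, parcs = {0..<m} \<times> {m..<m + n} \<union> {m..<m + n} \<times> {0..<m}\<rparr>"

lemma complete_bipartite_digraph_complete_bipartite_graph:
  "complete_bipartite_digraph m n (with_proj (complete_bipartite_graph m n))"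
proof -
  let ?G = "complete_bipartite_graph m n"
  have "pverts ?G = {0..<m} \<union> {m..<m + n} \<and> {0..<m} \<inter> {m..<m + n} = {} \<and>
    card {0..<m} = m \<and> card {m..<m + n} = n \<and>
    parcs ?G = {0..<m} \<times> {m..<m + n} \<union> {m..<m + n} \<times> {0..<m}"
    unfolding complete_bipartite_graph_def by auto
  moreover have "finite (pverts ?G)"
    unfolding complete_bipartite_graph_def by simp
  ultimately show ?thesis
    unfolding complete_bipartite_digraph_pair_def by blast
qed

definition path_graph :: "nat \<Rightarrow> nat pair_pre_digraph" where
  "path_graph t =
     \<lparr>pverts = {0..<t}, parcs = {(i, j). i < t \<and> j < t \<and> (j = Suc i \<or> i = Suc j)}\<rparr>"

text \<open>
  A cycle is given by its list of arcs, so its length is the length of the list and its vertices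
  are the tails of its arcs. The bound on the length excludes going back and forth along a single
  edge, which counts as a cycle in a symmetric digraph.
\<close>

definition chorded_cycle :: "('a, 'b) pre_digraph \<Rightarrow> 'b awalk \<Rightarrow> bool" where
  "chorded_cycle G p \<longleftrightarrow> pre_digraph.cycle G p \<and> 3 \<le> length p \<and>
     (\<exists>u \<in> tail G ` set p. \<exists>v \<in> tail G ` set p. u \<rightarrow>\<^bsub>G\<^esub> v \<and>
        \<not> (\<exists>a \<in> set p. {tail G a, head G a} = {u, v}))"

definition chorded_pancyclic :: "('a, 'b) pre_digraph \<Rightarrow> bool" where
  "chorded_pancyclic G \<longleftrightarrow>
     (\<forall>m. 4 \<le> m \<and> m \<le> card (verts G) \<longrightarrow> (\<exists>p. chorded_cycle G p \<and> length p = m))"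

end

theory Submission
  imports Defs
begin

text \<open>
  A connected graph without induced claw and \<open>P\<^sub>4\<close> has no independent set of size three.
  If \<open>u\<close>, \<open>v\<close> are nonadjacent, every vertex is thus adjacent to one of them, and by
  \<open>P\<^sub>4\<close>-freeness the set \<open>R\<close> of their common neighbours is completely joined to its complement.
  As \<open>R\<close> separates \<open>u\<close> from \<open>v\<close>, it contains distinct \<open>r\<close>, \<open>s\<close>, and every vertex outside the
  four-cycle \<open>u r v s\<close> has two neighbours on it. Since there is no independent set of size three,
  the exchange argument of Chvatal and Erdos absorbs the outside vertices into the
  cycle one at a time. A cycle of length at least five through \<open>u, r, v, s\<close> cannot use all four
  edges of the four-cycle, so one of these is a chord.
  If the four-cycle itself has no chord, a fifth vertex is adjacent to two consecutive vertices of
  it, hence by \<open>P\<^sub>4\<close>-freeness to a third one, and can replace a vertex to produce a chord.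
\<close>

section \<open>Cycles as vertex lists\<close>

definition vertex_cycle :: "('a \<Rightarrow> 'a \<Rightarrow> bool) \<Rightarrow> 'a list \<Rightarrow> bool" where
  "vertex_cycle E xs \<longleftrightarrow> xs \<noteq> [] \<and> distinct xs \<and> successively E (xs @ [hd xs])"

text \<open>The arcs are listed in order of traversal, so that over \<open>parcs G\<close> the list
  is itself the closed walk that \<open>chorded_cycle\<close> asks for.\<close>

definition cycle_arcs :: "'a list \<Rightarrow> ('a \<times> 'a) list" where
  "cycle_arcs xs = zip xs (rotate1 xs)"

definition has_chord :: "('a \<Rightarrow> 'a \<Rightarrow> bool) \<Rightarrow> 'a list \<Rightarrow> bool" where
  "has_chord E xs \<longleftrightarrow> (\<exists>u \<in> set xs. \<exists>v \<in> set xs. E u v \<and>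
     \<not> (\<exists>a \<in> set (cycle_arcs xs). {fst a, snd a} = {u, v}))"

lemma vertex_cycle_append_commute:
  assumes "vertex_cycle E (xs @ ys)"
  shows "vertex_cycle E (ys @ xs)"
  using assms unfolding vertex_cycle_def
  by (cases xs; cases ys) (auto simp: successively_append_iff successively_Cons hd_append)

section \<open>Positions on a cycle, and chords forced by a four-cycle\<close>

definition cyclic_next :: "nat \<Rightarrow> nat \<Rightarrow> nat \<Rightarrow> bool" where
  "cyclic_next n p q \<longleftrightarrow> p < n \<and> (q = Suc p \<and> q < n \<or> Suc p = n \<and> q = 0)"

text \<open>\<open>cyclic_next n\<close> is the successor modulo \<open>n\<close>, spelled out
  without \<open>mod\<close> for linear arithmetic. Being functional and injective, it forces the
  four steps, with \<open>i \<noteq> k\<close> and \<open>j \<noteq> l\<close>, to go the same way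
  round, and four steps one way do not return to the start when \<open>5 \<le> n\<close>.\<close>

lemma cyclic_next_no_four_cycle:
  assumes "cyclic_next n i j \<or> cyclic_next n j i" "cyclic_next n j k \<or> cyclic_next n k j"
    "cyclic_next n k l \<or> cyclic_next n l k" "cyclic_next n l i \<or> cyclic_next n i l"
    and "5 \<le> n" "i \<noteq> k" "j \<noteq> l"
  shows False
proof -
  have inj: "p = p'" if "cyclic_next n p q" "cyclic_next n p' q" for p p' q
    using that unfolding cyclic_next_def by linarith
  have fn: "q = q'" if "cyclic_next n p q" "cyclic_next n p q'" for p q q'
    using that unfolding cyclic_next_def by linarith
  have no: False
    if "cyclic_next n i j" "cyclic_next n j k" "cyclic_next n k l" "cyclic_next n l i" for i j k l
    using that assms(5) unfolding cyclic_next_def by linarith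
  show False using inj fn no assms(1-4,6,7) by metis
qed

lemma cycle_arcs_edge_index:
  assumes "p \<in> set (cycle_arcs xs)" "distinct xs" "{fst p, snd p} = {xs ! i, xs ! j}"
    "i < length xs" "j < length xs"
  shows "cyclic_next (length xs) i j \<or> cyclic_next (length xs) j i"
proof -
  obtain k where k: "k < length xs" "p = (xs ! k, xs ! (Suc k mod length xs))"
    using assms(1) unfolding cycle_arcs_def
    by (auto simp: in_set_zip nth_rotate1 prod_eq_iff)
  let ?l = "Suc k mod length xs"
  have l: "?l < length xs" using k(1) by (intro mod_less_divisor) linarith
  have "xs ! k = xs ! i \<and> xs ! ?l = xs ! j \<or> xs ! k = xs ! j \<and> xs ! ?l = xs ! i"
    using assms(3) k(2) by (auto simp: doubleton_eq_iff)
  then have "k = i \<and> ?l = j \<or> k = j \<and> ?l = i"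
    using assms(2,4,5) k(1) l by (simp add: nth_eq_iff_index_eq)
  moreover have "cyclic_next (length xs) k ?l"
    using k(1) unfolding cyclic_next_def by (cases "Suc k = length xs") auto
  ultimately show ?thesis by metis
qed

text \<open>Without a chord, all four edges would join consecutive positions of \<open>xs\<close>
  and so form a four-cycle inside a longer cycle.\<close>

lemma has_chord_through_four_cycle:
  assumes "distinct xs" "5 \<le> length xs" "{a, b, c, d} \<subseteq> set xs" "distinct [a, b, c, d]"
    and "E a b" "E b c" "E c d" "E d a"
  shows "has_chord E xs"
proof (rule ccontr)
  assume no: "\<not> has_chord E xs"
  obtain i j k l where idx: "i < length xs" "j < length xs" "k < length xs" "l < length xs"
    and eq: "xs ! i = a" "xs ! j = b" "xs ! k = c" "xs ! l = d"
    using assms(3) by (auto simp: in_set_conv_nth)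
  have adj: "cyclic_next (length xs) p q \<or> cyclic_next (length xs) q p"
    if "E (xs ! p) (xs ! q)" "p < length xs" "q < length xs" for p q
  proof -
    have "\<exists>a \<in> set (cycle_arcs xs). {fst a, snd a} = {xs ! p, xs ! q}"
      using no that unfolding has_chord_def by (meson nth_mem)
    then show ?thesis using cycle_arcs_edge_index[OF _ assms(1) _ that(2,3)] by blast
  qed
  have "i \<noteq> k" "j \<noteq> l" using assms(4) eq by auto
  then show False
    using cyclic_next_no_four_cycle[OF adj[of i j] adj[of j k] adj[of k l] adj[of l i] assms(2)]
      idx eq assms(5-8) by simp
qed

section \<open>Absorption of a vertex into a cycle\<close>

lemma successively_append_overlap:
  assumes "successively P (xs @ [b])" "successively P (b # ys)"
  shows "successively P (xs @ b # ys)"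
  using assms by (auto simp: successively_append_iff)

text \<open>This is the Chvatal-Erdos exchange. If \<open>x\<close> is adjacent to the successor of
  \<open>a\<close> or of \<open>b\<close> on the cycle, it fits in between; otherwise these two
  successors are adjacent to each other, and the cycle can be rerouted through
  \<open>x\<close>.\<close>

lemma vertex_cycle_insert_vertex:
  assumes cyc: "vertex_cycle E xs"
    and sym: "\<And>x y. E x y \<Longrightarrow> E y x"
    and indep: "\<And>x y z. \<lbrakk>x \<in> W; y \<in> W; z \<in> W; distinct [x, y, z]\<rbrakk> \<Longrightarrow> E x y \<or> E y z \<or> E x z"
    and W: "set xs \<subseteq> W" "x \<in> W" "x \<notin> set xs"
    and nb: "a \<in> set xs" "b \<in> set xs" "a \<noteq> b" "E x a" "E x b"
  shows "\<exists>ys. vertex_cycle E ys \<and> set ys = insert x (set xs) \<and> length ys = Suc (length xs)"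
proof -
  obtain ps qs where xs: "xs = ps @ a # qs" using nb(1) by (auto dest: split_list)
  have "b \<in> set (qs @ ps)" using nb(2,3) xs by auto
  then obtain ys zs where yz: "qs @ ps = ys @ b # zs" by (meson split_list)
  have "vertex_cycle E (a # ys @ b # zs)"
    using vertex_cycle_append_commute[of E ps "a # qs"] cyc xs yz by simp
  then have dist: "distinct (a # ys @ b # zs)"
    and path: "successively E (a # ys @ [b])" "successively E (b # zs @ [a])"
    unfolding vertex_cycle_def
    by (auto simp: successively_append_iff successively_Cons hd_append split: if_splits)
  have set_xs: "insert a (insert b (set ys \<union> set zs)) = set xs"
    and len: "length xs = length ys + length zs + 2"
    using arg_cong[OF yz, of set] arg_cong[OF yz, of length] unfolding xs by auto
  have x: "x \<notin> set (a # ys @ b # zs)" using W(3) set_xs by auto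
  have ax: "E a x" and bx: "E b x" using nb(4,5) sym by auto
  \<comment> \<open>The length follows from distinctness and the vertex set, so each new cycle only
    needs these and its adjacencies.\<close>
  have ext: ?thesis
    if "distinct us" "set us = insert x (set (a # ys @ b # zs))"
      "us \<noteq> []" "successively E (us @ [hd us])" for us
  proof -
    have "length us = Suc (length xs)"
      using distinct_card[OF that(1)] card_insert_disjoint[OF finite_set x] len
      unfolding that(2) distinct_card[OF dist] by simp
    moreover have "set us = insert x (set xs)" using that(2) set_xs by auto
    ultimately show ?thesis using that(1,3,4) unfolding vertex_cycle_def by blast
  qed
  \<comment> \<open>An empty \<open>ys\<close> or \<open>zs\<close> falls under the first two cases,
    because then the successor of \<open>a\<close> is \<open>b\<close>, or that of \<open>b\<close>
    is \<open>a\<close>, a neighbour of \<open>x\<close> either way.\<close>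
  consider "successively E (x # ys @ [b])" | "successively E (x # zs @ [a])"
    | y ys' z zs' where "ys = y # ys'" "zs = z # zs'" "\<not> E x y" "\<not> E x z"
    using path nb(4,5) by (cases ys; cases zs) auto
  then show ?thesis
  proof cases
    case 1
    then show ?thesis
      using successively_append_overlap[of E "a # x # ys" b "zs @ [a]"] path ax dist x
      by (intro ext[of "a # x # ys @ b # zs"]) auto
  next
    case 2
    then show ?thesis
      using successively_append_overlap[of E "a # ys" b "x # zs @ [a]"] path bx dist x
      by (intro ext[of "a # ys @ b # x # zs"]) auto
  next
    case 3
    \<comment> \<open>The new cycle goes from \<open>a\<close> through \<open>x\<close> to
      \<open>b\<close>, back along \<open>ys\<close> to \<open>y\<close>, across to
      \<open>z\<close>, and on along \<open>zs\<close> to \<open>a\<close>.\<close>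
    have "E y z" using indep[of y z x] 3 W dist x set_xs sym by auto
    moreover have "successively E (rev (a # ys @ [b]))"
    proof -
      have "(\<lambda>x y. E y x) = E" using sym by (auto simp: fun_eq_iff)
      with successively_rev[of E "a # ys @ [b]"] path(1) show ?thesis by metis
    qed
    ultimately show ?thesis
      using path(2) 3(1,2) ax nb(5) dist x
      by (intro ext[of "a # x # b # rev ys @ zs"])
        (auto simp: successively_append_iff successively_Cons hd_append simp del: successively_rev
          split: if_splits)
  qed
qed

section \<open>The structure of claw- and \<open>P\<^sub>4\<close>-free graphs\<close>

text \<open>Connectedness after deleting \<open>S\<close> is stated as a closure principle: a set
  that meets \<open>V - S\<close> and cannot be left along edges into \<open>V - S\<close> covers
  it. Each later use then only has to check closure.\<close>

locale two_connected_claw_P4_free =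
  fixes V :: "'a set" and E :: "'a \<Rightarrow> 'a \<Rightarrow> bool"
  assumes finite_V: "finite V"
    and edge_in_V: "E x y \<Longrightarrow> x \<in> V \<and> y \<in> V"
    and edge_sym: "E x y \<Longrightarrow> E y x"
    and edge_irrefl: "\<not> E x x"
    and claw_free: "\<lbrakk>E c x; E c y; E c z; distinct [x, y, z]\<rbrakk> \<Longrightarrow> E x y \<or> E y z \<or> E x z"
    and P4_free: "\<lbrakk>E a b; E b c; E c d; distinct [a, b, c, d]\<rbrakk> \<Longrightarrow> E a c \<or> E b d \<or> E a d"
    and two_connected: "\<lbrakk>S \<subseteq> V; card S < 2; x \<in> A; x \<in> V - S;
      \<And>y z. \<lbrakk>y \<in> A; z \<in> V - S; E y z\<rbrakk> \<Longrightarrow> z \<in> A\<rbrakk> \<Longrightarrow> V - S \<subseteq> A"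
begin

text \<open>The vertices within distance two of \<open>x\<close> are closed under adjacency, since a
  shortest path to a vertex at distance three would be an induced \<open>P_4\<close>.\<close>

lemma nonadjacent_common_neighbour:
  assumes "x \<in> V" "y \<in> V" "x \<noteq> y" "\<not> E x y"
  obtains w where "E x w" "E w y"
proof -
  let ?A = "{y. y = x \<or> E x y \<or> (\<exists>w. E x w \<and> E w y)}"
  have "z \<in> ?A" if y: "y \<in> ?A" and yz: "E y z" for y z
  proof (rule ccontr)
    assume z: "z \<notin> ?A"
    then obtain w where w: "E x w" "E w y" "\<not> E x y" "x \<noteq> y" using y yz by auto
    moreover have "\<not> E w z" "z \<noteq> x" "\<not> E x z" using z w(1) by auto
    ultimately show False
      using P4_free[of x w y z] yz edge_irrefl by auto
  qed
  then have "V - {} \<subseteq> ?A" using assms(1) by (intro two_connected[of "{}" x]) auto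
  then show ?thesis using assms that by blast
qed

text \<open>Take common neighbours \<open>w\<close> of \<open>x\<close>, \<open>y\<close> and
  \<open>w'\<close> of \<open>y\<close>, \<open>z\<close>. By claw-freeness neither is adjacent to
  the third vertex, so \<open>x w w' z\<close> or \<open>x w y w'\<close> is an induced
  \<open>P_4\<close>, according to whether \<open>w\<close> and \<open>w'\<close> are
  adjacent.\<close>

lemma no_independent_triple:
  assumes "x \<in> V" "y \<in> V" "z \<in> V" "distinct [x, y, z]"
  shows "E x y \<or> E y z \<or> E x z"
proof (rule ccontr)
  assume n: "\<not> ?thesis"
  obtain w where w: "E x w" "E w y"
    using nonadjacent_common_neighbour[of x y] assms n by auto
  obtain w' where w': "E y w'" "E w' z"
    using nonadjacent_common_neighbour[of y z] assms n by auto
  have 1: "\<not> E w z" using claw_free[of w x y z] w n assms(4) edge_sym by blast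
  have 2: "\<not> E x w'" using claw_free[of w' x y z] w' n assms(4) edge_sym by blast
  have "w \<noteq> w'" using 1 w' by auto
  show False
  proof (cases "E w w'")
    case True
    then show ?thesis
      using P4_free[of x w w' z] w w' 1 2 n assms(4) \<open>w \<noteq> w'\<close> edge_irrefl by auto
  next
    case False
    have "x \<noteq> w'" using w'(2) n by auto
    then show ?thesis
      using P4_free[of x w y w'] w w' 1 2 n assms(4) \<open>w \<noteq> w'\<close> False edge_irrefl by auto
  qed
qed

lemma common_neighbours_joined:
  assumes "\<not> E u v" "u \<noteq> v" "u \<in> V" "v \<in> V" "E r u" "E r v"
    "x \<in> V" "\<not> (E x u \<and> E x v)"
  shows "E r x"
proof -
  \<comment> \<open>By symmetry in \<open>u\<close> and \<open>v\<close>, let \<open>v\<close> be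
    the one not adjacent to \<open>x\<close>. If \<open>x\<close> is neither of them, it is adjacent
    to \<open>u\<close>, and only the edge \<open>r x\<close> keeps \<open>v r u x\<close> from
    being induced.\<close>
  have *: "E r x" if "\<not> E u v" "u \<noteq> v" "u \<in> V" "v \<in> V" "E r u" "E r v" "\<not> E x v" for u v
  proof (cases "x = u \<or> x = v")
    case False
    have "E x u" using no_independent_triple[of x u v] that assms(7) False by auto
    then show ?thesis
      using P4_free[of v r u x] that False edge_sym edge_irrefl[of v] edge_irrefl[of r] edge_irrefl[of u]
        edge_irrefl[of x] by (metis distinct_length_2_or_more distinct_singleton)
  qed (use that in auto)
  show ?thesis using *[of u v] *[of v u] assms edge_sym by blast
qed

text \<open>The common neighbours separate \<open>u\<close> from \<open>v\<close>, so by
  2-connectedness there are at least two.\<close>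

lemma two_common_neighbours:
  assumes "\<not> E u v" "u \<noteq> v" "u \<in> V" "v \<in> V"
  obtains r s where "r \<noteq> s" "E r u" "E r v" "E s u" "E s v"
proof -
  let ?R = "{r. E r u \<and> E r v}"
  have sub: "?R \<subseteq> V" using edge_in_V by auto
  have "\<not> card ?R < 2"
  proof
    assume less: "card ?R < 2"
    \<comment> \<open>This set contains \<open>u\<close> but not \<open>v\<close>. An edge
      \<open>y z\<close> leaving it outside \<open>?R\<close> would give the induced path
      \<open>u y z v\<close>.\<close>
    let ?A = "{x \<in> V. \<not> E x v \<and> x \<noteq> v}"
    have "z \<in> ?A" if y: "y \<in> ?A" and z: "z \<in> V - ?R" and yz: "E y z" for y z
    proof (rule ccontr)
      assume "z \<notin> ?A"
      then have zv: "E z v" using z yz y edge_sym by auto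
      then have "\<not> E z u" using z by auto
      moreover have "y \<noteq> u" using calculation yz edge_sym by auto
      moreover have "E y u" using no_independent_triple[of y u v] assms y calculation by auto
      ultimately show False
        using P4_free[of u y z v] yz zv y assms edge_sym edge_irrefl
        by (metis (mono_tags, lifting) distinct_length_2_or_more distinct_singleton mem_Collect_eq)
    qed
    then have "V - ?R \<subseteq> ?A"
      using two_connected[OF sub less, of u ?A] assms edge_irrefl by auto
    moreover have "v \<in> V - ?R" using assms edge_irrefl by auto
    ultimately show False by auto
  qed
  then obtain T where "T \<subseteq> ?R" "card T = 2" by (meson not_less obtain_subset_with_card_n)
  then obtain r s where "r \<noteq> s" "r \<in> ?R" "s \<in> ?R" by (auto simp: card_2_iff)
  then show ?thesis using that by blast
qed

text \<open>The two neighbours are required on the fixed four-cycle, so they remain available on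
  every larger cycle containing \<open>a\<close>, \<open>b\<close>, \<open>c\<close>,
  \<open>d\<close>.\<close>

definition absorbing :: "'a \<Rightarrow> 'a \<Rightarrow> 'a \<Rightarrow> 'a \<Rightarrow> bool" where
  "absorbing a b c d \<longleftrightarrow> distinct [a, b, c, d] \<and> E a b \<and> E b c \<and> E c d \<and> E d a \<and>
     (\<forall>x \<in> V - {a, b, c, d}. \<exists>p \<in> {a, b, c, d}. \<exists>q \<in> {a, b, c, d}. p \<noteq> q \<and> E x p \<and> E x q)"

lemma absorbing_vertex_cycles:
  assumes "absorbing a b c d" "4 \<le> m" "m \<le> card V"
  shows "\<exists>xs. vertex_cycle E xs \<and> {a, b, c, d} \<subseteq> set xs \<and> set xs \<subseteq> V \<and> length xs = m"
  using assms(2,3)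
proof (induction m rule: dec_induct)
  case base
  show ?case
    using assms(1) edge_in_V unfolding absorbing_def vertex_cycle_def
    by (intro exI[of _ "[a, b, c, d]"]) auto
next
  case (step m)
  then obtain xs where xs: "vertex_cycle E xs" "{a, b, c, d} \<subseteq> set xs" "set xs \<subseteq> V" "length xs = m"
    by auto
  have "card (set xs) < card V" using xs(4) step card_length[of xs] by simp
  then obtain x where x: "x \<in> V" "x \<notin> set xs" using xs(3) by (metis less_irrefl subsetI subset_antisym)
  then have "x \<in> V - {a, b, c, d}" using xs(2) by blast
  then obtain p q where pq: "p \<in> {a, b, c, d}" "q \<in> {a, b, c, d}" "p \<noteq> q" "E x p" "E x q"
    using assms(1) unfolding absorbing_def by meson
  have "p \<in> set xs" "q \<in> set xs" using pq(1,2) xs(2) by blast+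
  then obtain ys where "vertex_cycle E ys" "set ys = insert x (set xs)" "length ys = Suc (length xs)"
    using vertex_cycle_insert_vertex[OF xs(1) edge_sym no_independent_triple xs(3) x _ _ pq(3-5)]
    by blast
  then show ?case using xs x by (intro exI[of _ ys]) auto
qed

lemma ex_absorbing:
  assumes "5 \<le> card V"
  obtains a b c d where "absorbing a b c d"
proof (cases "\<exists>u \<in> V. \<exists>v \<in> V. u \<noteq> v \<and> \<not> E u v")
  case True
  then obtain u v where uv: "\<not> E u v" "u \<noteq> v" "u \<in> V" "v \<in> V" by auto
  obtain r s where rs: "r \<noteq> s" "E r u" "E r v" "E s u" "E s v"
    using two_common_neighbours[OF uv] .
  \<comment> \<open>The two neighbours are opposite corners: \<open>u\<close> and \<open>v\<close>
    if \<open>x\<close> is adjacent to both, otherwise \<open>r\<close> and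
    \<open>s\<close>.\<close>
  have "\<exists>p \<in> {u, r, v, s}. \<exists>q \<in> {u, r, v, s}. p \<noteq> q \<and> E x p \<and> E x q" if "x \<in> V" for x
  proof (cases "E x u \<and> E x v")
    case True
    then show ?thesis using uv(2) by blast
  next
    case False
    then have "E x r" "E x s"
      using common_neighbours_joined[OF uv rs(2,3) that] common_neighbours_joined[OF uv rs(4,5) that]
        edge_sym by blast+
    then show ?thesis using rs(1) by blast
  qed
  moreover have "distinct [u, r, v, s]" using uv rs edge_irrefl by auto
  moreover have "E u r" "E r v" "E v s" "E s u" using rs edge_sym by blast+
  ultimately have "absorbing u r v s" unfolding absorbing_def by blast
  then show ?thesis using that by blast
next
  \<comment> \<open>The graph is complete here, so any four vertices serve.\<close>
  case False
  have "4 \<le> card V" using assms by simp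
  then obtain T where T: "T \<subseteq> V" "card T = 4" by (rule obtain_subset_with_card_n)
  have "finite T" using T(1) finite_V by (rule finite_subset)
  then obtain ws where ws: "set ws = T" "distinct ws" using finite_distinct_list by blast
  then have "length ws = 4" using T(2) distinct_card by metis
  then obtain a b c d where "ws = [a, b, c, d]"
    by (auto simp: numeral_eq_Suc length_Suc_conv)
  then have abcd: "a \<in> V" "b \<in> V" "c \<in> V" "d \<in> V" "distinct [a, b, c, d]"
    using ws T(1) by auto
  have adj: "E x y" if "x \<in> V" "y \<in> V" "x \<noteq> y" for x y using False that by blast
  have "absorbing a b c d" unfolding absorbing_def using abcd adj by auto
  then show ?thesis using that by blast
qed

lemma ex_chorded_four_cycle:
  assumes "5 \<le> card V"
  obtains a b c d where "distinct [a, b, c, d]" "E a b" "E b c" "E c d" "E d a" "E a c"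
proof -
  note chorded = that
  obtain a b c d where abcd: "absorbing a b c d" using ex_absorbing[OF assms] .
  have dist: "distinct [a, b, c, d]" and e: "E a b" "E b c" "E c d" "E d a"
    using abcd unfolding absorbing_def by auto
  have "card {a, b, c, d} < card V" using assms dist by simp
  then obtain x where x: "x \<in> V" "x \<notin> {a, b, c, d}"
    using edge_in_V[OF e(1)] edge_in_V[OF e(3)]
    by (metis empty_subsetI insert_subset less_irrefl subsetI subset_antisym)
  show thesis
  proof (cases "E a c \<or> E b d")
    case True
    then show ?thesis using chorded[of a b c d] chorded[of b c d a] dist e by auto
  next
    case False
    then have ne: "\<not> E a c" "\<not> E c a" "\<not> E b d" "\<not> E d b" using edge_sym by blast+
    \<comment> \<open>The path \<open>x p s r\<close> is not induced, so \<open>x\<close> is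
      adjacent to \<open>s\<close> or to \<open>r\<close>. It then replaces \<open>r\<close> or
      \<open>s\<close> respectively, and its edge to \<open>p\<close> or to \<open>q\<close> is the
      chord.\<close>
    have triangle: thesis
      if h: "distinct [p, q, r, s, x]" "E p q" "E q r" "E r s" "E s p" "\<not> E p r" "\<not> E r p"
        "E x p" "E x q" for p q r s
    proof -
      have h': "E p s" "E s r" "E q x" "E p x" using h edge_sym by blast+
      have "E x s \<or> E x r"
        using P4_free[of x p s r] h h' by auto
      then show thesis
      proof
        assume "E x s"
        then show thesis using chorded[of p q x s] h h' by auto
      next
        assume "E x r"
        then have "E r x" by (rule edge_sym)
        then show thesis using chorded[of q r x p] h h' by auto
      qed
    qed
    \<comment> \<open>Both diagonals are missing, so \<open>x\<close> has a neighbour in each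
      opposite pair, hence two consecutive ones.\<close>
    have "E x a \<or> E x c" "E x b \<or> E x d"
      using no_independent_triple[of x a c] no_independent_triple[of x b d] ne x dist
        edge_in_V[OF e(1)] edge_in_V[OF e(3)] by auto
    then consider "E x a" "E x b" | "E x b" "E x c" | "E x c" "E x d" | "E x d" "E x a" by blast
    then show ?thesis
    proof cases
      case 1
      then show ?thesis using triangle[of a b c d] dist e ne x(2) by auto
    next
      case 2
      then show ?thesis using triangle[of b c d a] dist e ne x(2) by auto
    next
      case 3
      then show ?thesis using triangle[of c d a b] dist e ne x(2) by auto
    next
      case 4
      then show ?thesis using triangle[of d a b c] dist e ne x(2) by auto
    qed
  qed
qed

text \<open>Length four is treated apart: there the absorbing four-cycle may be the whole cycle, and
  its edges are then no chords.\<close>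

lemma ex_chorded_vertex_cycle:
  assumes "5 \<le> card V" "4 \<le> m" "m \<le> card V"
  shows "\<exists>xs. vertex_cycle E xs \<and> set xs \<subseteq> V \<and> length xs = m \<and> has_chord E xs"
proof (cases "m = 4")
  case True
  obtain a b c d where "distinct [a, b, c, d]" "E a b" "E b c" "E c d" "E d a" "E a c"
    using ex_chorded_four_cycle[OF assms(1)] .
  then have "vertex_cycle E [a, b, c, d]" "has_chord E [a, b, c, d]"
    unfolding vertex_cycle_def has_chord_def cycle_arcs_def
    by (auto simp: doubleton_eq_iff intro!: exI[of _ a] exI[of _ c])
  then show ?thesis using True edge_in_V \<open>E a b\<close> \<open>E c d\<close> by (intro exI[of _ "[a, b, c, d]"]) auto
next
  case False
  obtain a b c d where abcd: "absorbing a b c d" using ex_absorbing[OF assms(1)] .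
  obtain xs where xs: "vertex_cycle E xs" "{a, b, c, d} \<subseteq> set xs" "set xs \<subseteq> V" "length xs = m"
    using absorbing_vertex_cycles[OF abcd assms(2,3)] by auto
  moreover have "has_chord E xs"
    using has_chord_through_four_cycle[of xs a b c d E] abcd xs False assms(2)
    unfolding absorbing_def vertex_cycle_def by auto
  ultimately show ?thesis by auto
qed

end

section \<open>Transfer to digraphs\<close>

text \<open>To refute \<open>free_of\<close> it suffices to give the vertices of an induced copy of
  \<open>H\<close> as a map \<open>f\<close>. The isomorphism runs from the copy to
  \<open>H\<close>, hence the inverse of \<open>f\<close>.\<close>

lemma free_of_embedding:
  fixes G :: "'a pair_pre_digraph" and H :: "'c pair_pre_digraph"
  assumes free: "free_of \<H> (with_proj G)" "with_proj H \<in> \<H>"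
    and wf: "pair_wf_digraph G" "parcs H \<subseteq> pverts H \<times> pverts H"
    and f: "inj_on f (pverts H)" "f ` pverts H \<subseteq> pverts G"
    and arcs: "\<And>i j. \<lbrakk>i \<in> pverts H; j \<in> pverts H\<rbrakk> \<Longrightarrow> (f i, f j) \<in> parcs G \<longleftrightarrow> (i, j) \<in> parcs H"
  shows False
proof -
  interpret G: pair_wf_digraph G by (fact wf)
  let ?W = "f ` pverts H" and ?g = "the_inv_into (pverts H) f"
  let ?F = "with_proj \<lparr>pverts = ?W, parcs = parcs G \<inter> ?W \<times> ?W\<rparr>"
  have wfF: "wf_digraph ?F" by unfold_locales auto
  have ind: "induced_subgraph ?F (with_proj G)"
    using f(2) wfF G.wf_digraph_axioms
    unfolding induced_subgraph_def subgraph_def compatible_def by auto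
  have g: "?g (f i) = i" if "i \<in> pverts H" for i
    using that f(1) by (simp add: the_inv_into_f_f)
  \<comment> \<open>\<open>app_iso\<close> takes its tail and head maps from this record; the choice
    of \<open>fst\<close> and \<open>snd\<close> makes the image equal to
    \<open>with_proj H\<close>.\<close>
  define h :: "('a, 'a \<times> 'a, 'c, 'c \<times> 'c) digraph_isomorphism" where
    "h = \<lparr>iso_verts = ?g, iso_arcs = map_prod ?g ?g, iso_head = snd, iso_tail = fst\<rparr>"
  have inj: "inj_on ?g ?W" using f(1) by (simp add: inj_on_the_inv_into)
  have "inj_on (map_prod ?g ?g) (parcs G \<inter> ?W \<times> ?W)"
    by (rule inj_on_subset[OF map_prod_inj_on[OF inj inj]]) auto
  then have iso: "pre_digraph.digraph_isomorphism ?F h"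
    unfolding pre_digraph.digraph_isomorphism_def h_def using wfF inj by auto
  have "map_prod ?g ?g ` (parcs G \<inter> ?W \<times> ?W) = parcs H"
  proof (intro equalityI subsetI)
    fix p assume "p \<in> parcs H"
    then obtain i j where ij: "p = (i, j)" "i \<in> pverts H" "j \<in> pverts H" "(f i, f j) \<in> parcs G"
      using wf(2) arcs by (cases p) auto
    then have "p = map_prod ?g ?g (f i, f j)" by (simp add: g)
    then show "p \<in> map_prod ?g ?g ` (parcs G \<inter> ?W \<times> ?W)" using ij by blast
  qed (auto simp: g arcs)
  moreover have "?g ` ?W = pverts H" by (auto simp: g image_image)
  ultimately have "with_proj H = app_iso h ?F"
    by (simp add: h_def app_iso_def with_proj_def)
  then have "digraph_iso ?F (with_proj H)" using iso unfolding digraph_iso_def by auto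
  then show False using free ind unfolding free_of_def by blast
qed

text \<open>\<open>connected\<close> means reachability in the symmetric closure, so
  \<open>P\<close> has to be invariant along arcs in both directions.\<close>

lemma connected_closed_set:
  assumes "connected K" "x \<in> verts K" "P x"
    and step: "\<And>a. \<lbrakk>a \<in> arcs K\<rbrakk> \<Longrightarrow> P (tail K a) \<longleftrightarrow> P (head K a)"
    and y: "y \<in> verts K"
  shows "P y"
proof -
  have "(x, y) \<in> rtrancl_on (verts K) (parcs (mk_symmetric K))"
    using assms(1,2) y unfolding connected_def strongly_connected_def reachable_def
    by (simp add: mk_symmetric_def)
  then show ?thesis
  proof (induction rule: rtrancl_on_induct)
    case (step y z)
    then show ?case using assms(4) by (auto simp: mk_symmetric_def)
  qed (simp add: assms(3))
qed

section \<open>From vertex lists to arc lists\<close>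

lemma cycle_arcs_Cons: "cycle_arcs (x # xs) = zip (x # xs) (xs @ [x])"
  by (simp add: cycle_arcs_def)

text \<open>The end \<open>w\<close> is separate from the start \<open>u\<close> because the
  induction moves the start only; a cycle is the case \<open>w = u\<close>.\<close>

lemma pcas_zip: "pcas u (zip (u # ys) (ys @ [w])) w"
  by (induction ys arbitrary: u) auto

lemma pawalk_verts_zip: "pawalk_verts u (zip (u # ys) (ys @ [w])) = u # ys @ [w]"
  by (induction ys arbitrary: u) auto

lemma set_zip_subset_iff:
  "set (zip (u # ys) (ys @ [w])) \<subseteq> A \<longleftrightarrow> successively (\<lambda>x y. (x, y) \<in> A) (u # ys @ [w])"
  by (induction ys arbitrary: u) auto

lemma (in pair_graph) chorded_cycle_of_vertex_cycle:
  assumes cyc: "vertex_cycle (\<lambda>x y. (x, y) \<in> parcs G) xs"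
    and "has_chord (\<lambda>x y. (x, y) \<in> parcs G) xs" "set xs \<subseteq> pverts G" "3 \<le> length xs"
  shows "chorded_cycle (with_proj G) (cycle_arcs xs)"
proof -
  obtain u ys where xs: "xs = u # ys" using assms(4) by (cases xs) auto
  have "awalk u (cycle_arcs xs) u"
    using cyc assms(3) set_zip_subset_iff[of u ys u "parcs G"] pcas_zip[of u ys u]
    unfolding awalk_def xs cycle_arcs_Cons vertex_cycle_def by auto
  \<comment> \<open>The closed walk meets \<open>u\<close> at both ends; dropping the first visit
    leaves \<open>ys @ [u]\<close>, a rearrangement of \<open>xs\<close>.\<close>
  moreover have "distinct (tl (pawalk_verts u (cycle_arcs xs)))"
    using cyc unfolding xs cycle_arcs_Cons pawalk_verts_zip vertex_cycle_def by auto
  moreover have "cycle_arcs xs \<noteq> []" unfolding xs cycle_arcs_Cons by (cases ys) auto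
  ultimately have "cycle (cycle_arcs xs)" unfolding cycle_def by auto
  moreover have "fst ` set (cycle_arcs xs) = set xs"
    by (simp add: cycle_arcs_def flip: set_map)
  ultimately show ?thesis
    using assms(2,4) unfolding chorded_cycle_def has_chord_def
    by (simp add: cycle_arcs_def)
qed

lemma pair_graph_two_connected_claw_P4_free:
  fixes G :: "'a pair_pre_digraph"
  assumes "pair_graph G"
    and conn: "k_connected 2 (with_proj G)"
    and free: "free_of {with_proj (complete_bipartite_graph 1 3), with_proj (path_graph 4)} (with_proj G)"
  shows "two_connected_claw_P4_free (pverts G) (\<lambda>x y. (x, y) \<in> parcs G)"
proof -
  interpret pair_graph G by fact
  have sym: "(y, x) \<in> parcs G" if "(x, y) \<in> parcs G" for x y
    using pair_sym_arcs that unfolding symmetric_def by (auto dest: symD)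
  have irr: "(x, x) \<notin> parcs G" for x using pair_no_loops by fastforce
  show ?thesis
  proof
    show "finite (pverts G)" by (fact pair_finite_verts)
    show "(x, y) \<in> parcs G \<Longrightarrow> x \<in> pverts G \<and> y \<in> pverts G" for x y using wellformed' by auto
    show "(x, y) \<in> parcs G \<Longrightarrow> (y, x) \<in> parcs G" for x y by (fact sym)
    show "(x, x) \<notin> parcs G" for x by (fact irr)
  next
    fix c x y z
    assume e: "(c, x) \<in> parcs G" "(c, y) \<in> parcs G" "(c, z) \<in> parcs G" and d: "distinct [x, y, z]"
    show "(x, y) \<in> parcs G \<or> (y, z) \<in> parcs G \<or> (x, z) \<in> parcs G"
    proof (rule ccontr)
      assume n: "\<not> ?thesis"
      then have n': "(y, x) \<notin> parcs G" "(z, y) \<notin> parcs G" "(z, x) \<notin> parcs G"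
        using sym by blast+
      have e': "(x, c) \<in> parcs G" "(y, c) \<in> parcs G" "(z, c) \<in> parcs G" using e sym by blast+
      have ne: "c \<noteq> x" "c \<noteq> y" "c \<noteq> z" using e irr by auto
      \<comment> \<open>Vertex \<open>0\<close> is the centre of the claw, so \<open>c\<close> comes
        first.\<close>
      let ?H = "complete_bipartite_graph 1 3" and ?f = "\<lambda>i. [c, x, y, z] ! i"
      have verts: "pverts ?H = {0, 1, 2, 3}"
        unfolding complete_bipartite_graph_def by auto
      show False
      proof (rule free_of_embedding[OF free, of ?H ?f])
        show "with_proj ?H \<in> {with_proj (complete_bipartite_graph 1 3), with_proj (path_graph 4)}"
          by simp
        show "pair_wf_digraph G" by unfold_locales
        show "parcs ?H \<subseteq> pverts ?H \<times> pverts ?H"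
          unfolding complete_bipartite_graph_def by auto
        show "inj_on ?f (pverts ?H)" unfolding verts using d ne by auto
        show "?f ` pverts ?H \<subseteq> pverts G"
          unfolding verts using e[THEN in_arcsD1] e[THEN in_arcsD2] by simp
      next
        fix i j
        assume "i \<in> pverts ?H" "j \<in> pverts ?H"
        then have "i \<in> {0, 1, 2, 3}" "j \<in> {0, 1, 2, 3}" unfolding verts .
        then show "(?f i, ?f j) \<in> parcs G \<longleftrightarrow> (i, j) \<in> parcs ?H"
          by (elim insertE emptyE; use n n' e e' irr in \<open>simp add: complete_bipartite_graph_def\<close>)
      qed
    qed
  next
    fix a b c d
    assume e: "(a, b) \<in> parcs G" "(b, c) \<in> parcs G" "(c, d) \<in> parcs G" and d: "distinct [a, b, c, d]"
    show "(a, c) \<in> parcs G \<or> (b, d) \<in> parcs G \<or> (a, d) \<in> parcs G"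
    proof (rule ccontr)
      assume n: "\<not> ?thesis"
      then have n': "(c, a) \<notin> parcs G" "(d, b) \<notin> parcs G" "(d, a) \<notin> parcs G"
        using sym by blast+
      have e': "(b, a) \<in> parcs G" "(c, b) \<in> parcs G" "(d, c) \<in> parcs G" using e sym by blast+
      let ?H = "path_graph 4" and ?f = "\<lambda>i. [a, b, c, d] ! i"
      have verts: "pverts ?H = {0, 1, 2, 3}"
        unfolding path_graph_def by auto
      show False
      proof (rule free_of_embedding[OF free, of ?H ?f])
        show "with_proj ?H \<in> {with_proj (complete_bipartite_graph 1 3), with_proj (path_graph 4)}"
          by simp
        show "pair_wf_digraph G" by unfold_locales
        show "parcs ?H \<subseteq> pverts ?H \<times> pverts ?H"
          unfolding path_graph_def by auto
        show "inj_on ?f (pverts ?H)" unfolding verts using d by auto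
        show "?f ` pverts ?H \<subseteq> pverts G"
          unfolding verts using e[THEN in_arcsD1] e[THEN in_arcsD2] by simp
      next
        fix i j
        assume "i \<in> pverts ?H" "j \<in> pverts ?H"
        then have "i \<in> {0, 1, 2, 3}" "j \<in> {0, 1, 2, 3}" unfolding verts .
        then show "(?f i, ?f j) \<in> parcs G \<longleftrightarrow> (i, j) \<in> parcs ?H"
          by (elim insertE emptyE; use n n' e e' irr in \<open>simp add: path_graph_def\<close>)
      qed
    qed
  next
    fix S x A
    assume S: "S \<subseteq> pverts G" "card S < 2" and x: "x \<in> A" "x \<in> pverts G - S"
      and cl: "\<And>y z. \<lbrakk>y \<in> A; z \<in> pverts G - S; (y, z) \<in> parcs G\<rbrakk> \<Longrightarrow> z \<in> A"
    let ?K = "with_proj G \<restriction> (pverts G - S)"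
    have K: "connected ?K" using conn S unfolding k_connected_def by simp
    show "pverts G - S \<subseteq> A"
    proof
      fix y assume y: "y \<in> pverts G - S"
      \<comment> \<open>Closure of \<open>A\<close> works along arcs; symmetry of \<open>G\<close>
        supplies the reverse direction.\<close>
      have "fst e \<in> A \<longleftrightarrow> snd e \<in> A" if "e \<in> arcs ?K" for e
        using that cl[of "fst e" "snd e"] cl[of "snd e" "fst e"] sym[of "fst e" "snd e"]
        by (auto simp: induce_subgraph_def)
      then show "y \<in> A"
        using connected_closed_set[OF K, of x "\<lambda>y. y \<in> A" y] x y
        by (simp add: induce_subgraph_def)
    qed
  qed
qed

theorem theorem8:
  fixes G :: "'a pair_pre_digraph"
  assumes "pair_graph G"
    and "k_connected 2 (with_proj G)"
    and "5 \<le> card (pverts G)"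
    and "free_of {with_proj (complete_bipartite_graph 1 3), with_proj (path_graph 4)} (with_proj G)"
  shows "chorded_pancyclic (with_proj G)"
proof -
  interpret pair_graph G by fact
  interpret two_connected_claw_P4_free "pverts G" "\<lambda>x y. (x, y) \<in> parcs G"
    by (rule pair_graph_two_connected_claw_P4_free[OF assms(1,2,4)])
  show ?thesis
    unfolding chorded_pancyclic_def
  proof (intro allI impI)
    fix m assume m: "4 \<le> m \<and> m \<le> card (verts (with_proj G))"
    then obtain xs where "vertex_cycle (\<lambda>x y. (x, y) \<in> parcs G) xs" "set xs \<subseteq> pverts G"
        "length xs = m" "has_chord (\<lambda>x y. (x, y) \<in> parcs G) xs"
      using ex_chorded_vertex_cycle[OF assms(3), of m] by auto
    then have "chorded_cycle (with_proj G) (cycle_arcs xs)" "length (cycle_arcs xs) = m"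
      using chorded_cycle_of_vertex_cycle m by (auto simp: cycle_arcs_def)
    then show "\<exists>p. chorded_cycle (with_proj G) p \<and> length p = m" by blast
  qed
qed

end
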